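(* Let $s:\mathcal{F}\to\mathbb{R}$ be the shear function defined as follows. For $j\in\mathbb{Z}$ let $E_j\in\mathcal{F}$ be the edge with endpoints $j$ and $\infty$. Set $s(E_{-16^j})=\log 2$ and $s(E_{16^j})=-\log 2$ for all $j\in\mathbb{N}\cup\{0\}$, and set $s(E)=0$ for every other edge $E\in\mathcal{F}$ (that is, for all other edges with endpoint $\infty$ and for all edges of $\mathcal{F}$ not having $\infty$ as an endpoint). Let $h_s:\hat{\mathbb{R}}\to\hat{\mathbb{R}}$ be the corresponding homeomorphism, normalized to be the identity on $[-1,1]$. Then no decoration on $h_s(\mathcal{F})$ has pinched lambda lengths.
   Context: $\mathbb{H}$ is the hyperbolic plane (upper half-plane model), with ideal boundary $\hat{\mathbb{R}}=\mathbb{R}\cup\{\infty\}$; $\hat{\mathbb{Q}}=\mathbb{Q}\cup\{\infty\}$. Farey triangulation: $\mathcal{F}$ is the orbit, under the group generated by hyperbolic reflections in the sides of the ideal triangle with vertices $0,1,\infty$, of that triangle; $\mathcal{F}$ also denotes the set of its edges (complete geodesics). Its vertex set is $\hat{\mathbb{Q}}$, and $\frac ab,\frac cd$ (in lowest terms, $\infty=\frac10$) are joined by an edge iff $|ad-bc|=1$. For a homeomorphism $h$ of $\hat{\mathbb{R}}$, $h(\mathcal{F})$ is the ideal triangulation whose edges $h(E)$ are the geodesics with endpoints the $h$-images of the endpoints of $E$, for $E\in\mathcal{F}$. Shear: let $\Delta_1,\Delta_2$ be two ideal triangles on opposite sides of a common edge $e$. Orient $e$ as part of the positively oriented boundary of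 $\Delta_1$. Let $x_i\in e$ be the point where the circle inscribed in $\Delta_i$ (tangent to its three sides) touches $e$. The shear along $e$ is the signed distance from $x_1$ to $x_2$ following the orientation of $e$. A shear function is any function $s:\mathcal{F}\to\mathbb{R}$. The homeomorphism (developing map) $h_s$ corresponding to $s$ is the orientation preserving homeomorphism, determined up to post-composition with an element of $\mathrm{PSL}_2(\mathbb{R})$, such that for each $E\in\mathcal{F}$ the shear along $h_s(E)$ of the two triangles of $h_s(\mathcal{F})$ adjacent to $h_s(E)$ equals $s(E)$. Decoration and lambda lengths: a decoration of $h_s(\mathcal{F})$ is a choice of one horocycle based at each vertex of $h_s(\mathcal{F})$. Given a decoration, for $E\in\mathcal{F}$ let $\delta(E)$ be the signed hyperbolic distance between the intersection points of $h_s(E)$ with the two chosen horocycles at its endpoints (positive if the corresponding horodisks are disjoint, negative if they overlap). The lambda length is $\lambda(E)=\sqrt{e^{\delta(E)}}$. The lambda lengths are pinched if there is $M>1$ with $\frac1{M}\le\lambda(E)\le M$ for all $E\in\mathcal{F}$. *)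

theory Defs
  imports "HOL-Analysis.Analysis"
begin

text \<open>
  The ideal boundary of the upper half-plane is modelled by \<^typ>\<open>real option\<close>, with
  \<^term>\<open>None\<close> in the role of the point at infinity. Complete geodesics and ideal triangles
  are given by their ideal vertices: an edge is a two-element set, a triangle a three-element set.
\<close>

type_synonym ideal_point = "real option"

definition ideal_boundary :: "ideal_point topology" where
  "ideal_boundary = Alexandroff_compactification euclideanreal"

text \<open>\<open>cyc a b c\<close>: the points are distinct and \<open>a, b, c\<close> are met in this order when traversing
  the boundary in the direction of increasing reals, that is, with the upper half-plane on the
  left. So \<open>a \<rightarrow> b \<rightarrow> c \<rightarrow> a\<close> is the positively oriented boundary of the ideal triangle.\<close>

fun cyc :: "ideal_point \<Rightarrow> ideal_point \<Rightarrow> ideal_point \<Rightarrow> bool" where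
  "cyc (Some a) (Some b) (Some c) \<longleftrightarrow> a < b \<and> b < c \<or> b < c \<and> c < a \<or> c < a \<and> a < b"
| "cyc None (Some b) (Some c) \<longleftrightarrow> b < c"
| "cyc (Some a) None (Some c) \<longleftrightarrow> c < a"
| "cyc (Some a) (Some b) None \<longleftrightarrow> a < b"
| "cyc _ _ _ \<longleftrightarrow> False"

definition orientation_preserving :: "(ideal_point \<Rightarrow> ideal_point) \<Rightarrow> bool" where
  "orientation_preserving h \<longleftrightarrow> (\<forall>a b c. cyc a b c \<longrightarrow> cyc (h a) (h b) (h c))"

definition upper_half_plane :: "complex set" where
  "upper_half_plane = {z. 0 < Im z}"

definition hdist :: "complex \<Rightarrow> complex \<Rightarrow> real" where
  "hdist z w = arcosh (1 + (cmod (z - w))\<^sup>2 / (2 * Im z * Im w))"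

fun geodesic :: "ideal_point \<Rightarrow> ideal_point \<Rightarrow> complex set" where
  "geodesic (Some a) (Some b) =
     {z \<in> upper_half_plane. cmod (z - complex_of_real ((a + b) / 2)) = \<bar>a - b\<bar> / 2}"
| "geodesic (Some a) None = {z \<in> upper_half_plane. Re z = a}"
| "geodesic None (Some b) = {z \<in> upper_half_plane. Re z = b}"
| "geodesic None None = {}"

text \<open>For \<open>z\<close>, \<open>w\<close> on the geodesic oriented from \<open>p\<close> to \<open>q\<close>: \<open>z\<close> does not come after \<open>w\<close>.\<close>

fun precedes :: "ideal_point \<Rightarrow> ideal_point \<Rightarrow> complex \<Rightarrow> complex \<Rightarrow> bool" where
  "precedes (Some a) (Some b) z w \<longleftrightarrow> (if a < b then Re z \<le> Re w else Re w \<le> Re z)"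
| "precedes (Some a) None z w \<longleftrightarrow> Im z \<le> Im w"
| "precedes None (Some b) z w \<longleftrightarrow> Im w \<le> Im z"
| "precedes None None z w \<longleftrightarrow> False"

definition signed_dist :: "ideal_point \<Rightarrow> ideal_point \<Rightarrow> complex \<Rightarrow> complex \<Rightarrow> real" where
  "signed_dist p q z w = (if precedes p q z w then hdist z w else - hdist z w)"


definition hcircle :: "complex \<Rightarrow> real \<Rightarrow> complex set" where
  "hcircle c \<rho> = {z \<in> upper_half_plane. hdist c z = \<rho>}"

text \<open>A hyperbolic circle is tangent to a geodesic iff they meet in exactly one point. A circle
  tangent to all three sides of an ideal triangle necessarily lies in the triangle, since each
  other component of the complement of the sides is adjacent to one side only.\<close>

definition inscribed_circle :: "ideal_point \<Rightarrow> ideal_point \<Rightarrow> ideal_point \<Rightarrow> complex set" where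
  "inscribed_circle p q r = (THE C.
     (\<exists>c\<in>upper_half_plane. \<exists>\<rho>>0. C = hcircle c \<rho>) \<and>
     (\<exists>!z. z \<in> C \<inter> geodesic p q) \<and> (\<exists>!z. z \<in> C \<inter> geodesic q r) \<and> (\<exists>!z. z \<in> C \<inter> geodesic r p))"

definition tangency_point :: "ideal_point \<Rightarrow> ideal_point \<Rightarrow> ideal_point \<Rightarrow> complex" where
  "tangency_point p q r = (THE z. z \<in> inscribed_circle p q r \<inter> geodesic p q)"

text \<open>Shear along the edge \<open>{p, q}\<close> of the triangles \<open>{p, q, a}\<close> and \<open>{p, q, b}\<close>, to be used when
  \<open>cyc p q a\<close> and \<open>cyc q p b\<close>: the triangles then lie on opposite sides of the edge, and the
  orientation of the edge induced by \<open>{p, q, a}\<close> is from \<open>p\<close> to \<open>q\<close>.\<close>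

definition shear :: "ideal_point \<Rightarrow> ideal_point \<Rightarrow> ideal_point \<Rightarrow> ideal_point \<Rightarrow> real" where
  "shear p q a b = signed_dist p q (tangency_point p q a) (tangency_point p q b)"


text \<open>Action on the ideal boundary of the hyperbolic reflection in \<open>geodesic p q\<close>: the inversion
  in a Euclidean half-circle, or the Euclidean reflection in a vertical line.\<close>

fun reflection :: "ideal_point \<Rightarrow> ideal_point \<Rightarrow> ideal_point \<Rightarrow> ideal_point" where
  "reflection (Some a) (Some b) (Some x) =
     (if x = (a + b) / 2 then None
      else Some ((a + b) / 2 + ((a - b) / 2)\<^sup>2 / (x - (a + b) / 2)))"
| "reflection (Some a) (Some b) None = Some ((a + b) / 2)"
| "reflection (Some a) None (Some x) = Some (2 * a - x)"
| "reflection None (Some b) (Some x) = Some (2 * b - x)"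
| "reflection _ _ x = x"

text \<open>The generators are involutions, so closing under composition with them yields a group.\<close>

inductive_set farey_group :: "(ideal_point \<Rightarrow> ideal_point) set" where
  id: "id \<in> farey_group"
| refl_0_1: "g \<in> farey_group \<Longrightarrow> reflection (Some 0) (Some 1) \<circ> g \<in> farey_group"
| refl_1_inf: "g \<in> farey_group \<Longrightarrow> reflection (Some 1) None \<circ> g \<in> farey_group"
| refl_0_inf: "g \<in> farey_group \<Longrightarrow> reflection (Some 0) None \<circ> g \<in> farey_group"

definition farey_triangles :: "ideal_point set set" where
  "farey_triangles = {g ` {Some 0, Some 1, None} | g. g \<in> farey_group}"

definition farey_edges :: "ideal_point set set" where
  "farey_edges = {E. card E = 2 \<and> (\<exists>T\<in>farey_triangles. E \<subseteq> T)}"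

definition farey_vertices :: "ideal_point set" where
  "farey_vertices = \<Union> farey_triangles"

text \<open>A shear function is a function on \<^term>\<open>farey_edges\<close>; its values elsewhere are irrelevant.
  In \<open>developing_map s h\<close>, the sets \<open>{p, q, a}\<close> and \<open>{p, q, b}\<close> are the two triangles of the
  image triangulation that are adjacent to the image of \<open>E\<close>.\<close>

definition developing_map :: "(ideal_point set \<Rightarrow> real) \<Rightarrow> (ideal_point \<Rightarrow> ideal_point) \<Rightarrow> bool" where
  "developing_map s h \<longleftrightarrow>
     homeomorphic_map ideal_boundary ideal_boundary h \<and> orientation_preserving h \<and>
     (\<forall>E\<in>farey_edges. \<forall>p q a b.
        h ` E = {p, q} \<and> {p, q, a} \<in> (`) h ` farey_triangles \<and> {p, q, b} \<in> (`) h ` farey_triangles \<and>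
        cyc p q a \<and> cyc q p b \<longrightarrow> shear p q a b = s E)"


text \<open>The horocycles based at \<open>v\<close> are exactly the sets \<open>horocycle v t\<close> with \<open>t > 0\<close>, for a unique
  \<open>t\<close>: the Euclidean diameter if \<open>v\<close> is finite, the Euclidean height if \<open>v\<close> is infinite.\<close>

fun horocycle :: "ideal_point \<Rightarrow> real \<Rightarrow> complex set" where
  "horocycle (Some a) t = {z \<in> upper_half_plane. cmod (z - Complex a (t / 2)) = t / 2}"
| "horocycle None t = {z \<in> upper_half_plane. Im z = t}"

fun horodisk :: "ideal_point \<Rightarrow> real \<Rightarrow> complex set" where
  "horodisk (Some a) t = {z \<in> upper_half_plane. cmod (z - Complex a (t / 2)) < t / 2}"
| "horodisk None t = {z \<in> upper_half_plane. t < Im z}"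

text \<open>A decoration \<open>d\<close> chooses the horocycle \<open>horocycle v (d v)\<close> at each vertex \<open>v\<close> in \<open>V\<close>.\<close>

definition decoration :: "ideal_point set \<Rightarrow> (ideal_point \<Rightarrow> real) \<Rightarrow> bool" where
  "decoration V d \<longleftrightarrow> (\<forall>v\<in>V. 0 < d v)"

definition horocycle_dist :: "(ideal_point \<Rightarrow> real) \<Rightarrow> ideal_point \<Rightarrow> ideal_point \<Rightarrow> real" where
  "horocycle_dist d p q =
     (let x = (THE z. z \<in> geodesic p q \<inter> horocycle p (d p));
          y = (THE z. z \<in> geodesic p q \<inter> horocycle q (d q))
      in if horodisk p (d p) \<inter> horodisk q (d q) = {} then hdist x y else - hdist x y)"

definition lambda_length :: "(ideal_point \<Rightarrow> real) \<Rightarrow> ideal_point \<Rightarrow> ideal_point \<Rightarrow> real" where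
  "lambda_length d p q = sqrt (exp (horocycle_dist d p q))"

definition pinched :: "(ideal_point \<Rightarrow> ideal_point) \<Rightarrow> (ideal_point \<Rightarrow> real) \<Rightarrow> bool" where
  "pinched h d \<longleftrightarrow> (\<exists>M>1. \<forall>p q. {p, q} \<in> farey_edges \<longrightarrow>
     1 / M \<le> lambda_length d (h p) (h q) \<and> lambda_length d (h p) (h q) \<le> M)"

end

theory Submission
  imports Defs
begin

text \<open>
  The shears along the edges \<open>{n, \<infinity>}\<close> are the logarithmic ratios of consecutive increments
  \<open>D n = h (n + 1) - h n\<close>, once \<open>h\<close> is known to fix \<open>\<infinity>\<close>. The shear \<open>- ln 2\<close> at \<open>n = 16 ^ j\<close>
  halves the increment and the shear \<open>0\<close> at every other positive integer keeps it, so
  \<open>D n\<close> decreases to \<open>0\<close>.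

  On the other hand, let a decoration have a horocycle of height \<open>H\<close> at \<open>\<infinity>\<close> and of diameter
  \<open>t n\<close> at \<open>h n\<close>. The squared lambda lengths of \<open>{n, \<infinity>}\<close> and \<open>{n, n + 1}\<close> are \<open>H / t n\<close> and
  \<open>(D n)\<^sup>2 / (t n * t (n + 1))\<close> (\<open>lambda_length_squared_vertical\<close>, \<open>lambda_length_squared_finite\<close>).
  If all lambda lengths lie between \<open>1 / M\<close> and \<open>M\<close>, the first ones bound every \<open>t n\<close> from below
  by \<open>H / M\<^sup>2\<close>, and then the second ones bound every \<open>D n\<close> from below by \<open>H / M ^ 3\<close>. This
  contradicts the decay of the increments.

  Two facts about shears are needed. For triangles with a vertex at \<open>\<infinity>\<close> the inscribed circle can
  be written down, which gives the logarithmic ratio (\<open>shear_at_infinity\<close>). That \<open>h\<close> fixes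
  \<open>\<infinity>\<close> follows from the shear \<open>0\<close> along \<open>{0, \<infinity>}\<close>: it makes \<open>h \<infinity>\<close> and \<open>h 0 = 0\<close>
  harmonic with respect to \<open>h (-1) = -1\<close> and \<open>h 1 = 1\<close>. If \<open>h \<infinity>\<close> were a real number \<open>y\<close>, the
  isometry \<open>z \<mapsto> - 1 / (z - y)\<close> would carry the edge to a vertical line, where equality of the two
  tangency points is impossible (\<open>developing_map_fixes_infinity\<close>).
\<close>

section \<open>Hyperbolic distance\<close>

text \<open>Points of a geodesic are described below by polynomial equations in their real coordinates
  instead of the Euclidean norm.\<close>

declare geodesic.simps [simp del]

lemma cosh_abs_ln: "0 < r \<Longrightarrow> cosh \<bar>ln r\<bar> = (r + 1 / r) / (2::real)"
  by (simp add: cosh_ln_real inverse_eq_divide)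

lemma arcosh_eq_abs_ln:
  fixes r :: real
  assumes "0 < r"
  shows "arcosh ((r + 1 / r) / 2) = \<bar>ln r\<bar>"
  by (metis assms cosh_abs_ln arcosh_cosh_real abs_ge_zero)

lemma hdist_vertical:
  assumes "0 < u" "0 < v"
  shows "hdist (Complex b u) (Complex b v) = \<bar>ln (v / u)\<bar>"
proof -
  have "1 + (cmod (Complex b u - Complex b v))\<^sup>2 / (2 * u * v) = (v / u + 1 / (v / u)) / 2"
    using assms unfolding cmod_power2 by (simp add: field_simps power2_eq_square)
  then show ?thesis
    using arcosh_eq_abs_ln[of "v / u"] assms unfolding hdist_def complex.sel by (metis divide_pos_pos)
qed

lemma hdist_eq_iff_cosh:
  assumes "0 < Im c" "0 < Im z" "0 < \<rho>"
  shows "hdist c z = \<rho> \<longleftrightarrow> 1 + (cmod (c - z))\<^sup>2 / (2 * Im c * Im z) = cosh \<rho>"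
    (is "_ \<longleftrightarrow> ?X = _")
proof -
  have "1 \<le> ?X" using assms by simp
  then show ?thesis
    unfolding hdist_def using assms(3) by (metis arcosh_cosh_real cosh_arcosh_real less_imp_le)
qed

lemma hdist_eq_0_imp_eq:
  assumes "0 < Im z" "0 < Im w" "hdist z w = 0"
  shows "z = w"
proof -
  have "1 \<le> 1 + (cmod (z - w))\<^sup>2 / (2 * Im z * Im w)" using assms by simp
  then have "1 + (cmod (z - w))\<^sup>2 / (2 * Im z * Im w) = 1"
    using assms(3) unfolding hdist_def by (metis cosh_arcosh_real cosh_0)
  then show ?thesis using assms by simp
qed

section \<open>Circles inscribed in ideal triangles with a vertex at infinity\<close>

lemma mem_geodesic_Some_Some:
  "z \<in> geodesic (Some a) (Some b) \<longleftrightarrow> 0 < Im z \<and> (Re z - a) * (Re z - b) + (Im z)\<^sup>2 = 0"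
proof -
  have "cmod (z - complex_of_real ((a + b) / 2)) = \<bar>a - b\<bar> / 2 \<longleftrightarrow>
      (cmod (z - complex_of_real ((a + b) / 2)))\<^sup>2 = (\<bar>a - b\<bar> / 2)\<^sup>2"
    by (rule power2_eq_iff_nonneg[symmetric]) auto
  also have "\<dots> \<longleftrightarrow> (Re z - a) * (Re z - b) + (Im z)\<^sup>2 = 0"
    unfolding cmod_power2 power_divide power2_abs by (auto simp: field_simps power2_eq_square)
  finally show ?thesis by (simp add: upper_half_plane_def geodesic.simps)
qed

lemma mem_geodesic_Some_None: "z \<in> geodesic (Some a) None \<longleftrightarrow> 0 < Im z \<and> Re z = a"
  by (simp add: upper_half_plane_def geodesic.simps)

lemma geodesic_commute: "geodesic p q = geodesic q p"
  by (cases p; cases q) (auto simp: geodesic.simps add.commute abs_minus_commute)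

definition euclidean_circle :: "real \<Rightarrow> real \<Rightarrow> real \<Rightarrow> complex set" where
  "euclidean_circle m K R = {z. (Re z - m)\<^sup>2 + (Im z - K)\<^sup>2 = R\<^sup>2}"

lemma euclidean_circle_Im_pos:
  assumes "0 < R" "R < K" "z \<in> euclidean_circle m K R"
  shows "0 < Im z"
proof -
  have "(Im z - K)\<^sup>2 \<le> R\<^sup>2"
    using assms(3) unfolding euclidean_circle_def by (smt (verit) mem_Collect_eq zero_le_power2)
  then have "\<bar>Im z - K\<bar> \<le> R" using assms(1) by (simp add: abs_le_square_iff[symmetric])
  then show ?thesis using assms by linarith
qed

text \<open>Clearing the denominator of the hyperbolic distance leaves a quadratic equation; completing
  the square in \<open>Im z\<close> moves the centre up from \<open>Im c\<close> to \<open>Im c * cosh \<rho>\<close>.\<close>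

lemma hcircle_eq_euclidean_circle:
  assumes "0 < Im c" "0 < \<rho>"
  shows "hcircle c \<rho> = euclidean_circle (Re c) (Im c * cosh \<rho>) (Im c * sinh \<rho>)"
proof -
  have pos: "0 < Im c * sinh \<rho>" "Im c * sinh \<rho> < Im c * cosh \<rho>"
    using assms by (auto simp: sinh_less_cosh_real)
  have "z \<in> hcircle c \<rho> \<longleftrightarrow> z \<in> euclidean_circle (Re c) (Im c * cosh \<rho>) (Im c * sinh \<rho>)"
    if z: "0 < Im z" for z
  proof -
    have "z \<in> hcircle c \<rho> \<longleftrightarrow> 1 + (cmod (c - z))\<^sup>2 / (2 * Im c * Im z) = cosh \<rho>"
      using hdist_eq_iff_cosh[OF assms(1) z assms(2)] z
      by (simp add: hcircle_def upper_half_plane_def)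
    also have "\<dots> \<longleftrightarrow> (cmod (c - z))\<^sup>2 = (cosh \<rho> - 1) * (2 * Im c * Im z)"
      using assms(1) z by (auto simp: field_simps)
    also have "\<dots> \<longleftrightarrow> (Re z - Re c)\<^sup>2 + (Im z - Im c * cosh \<rho>)\<^sup>2 =
        (Im c)\<^sup>2 * ((cosh \<rho>)\<^sup>2 - 1)"
      unfolding cmod_power2 by (auto simp: algebra_simps power2_eq_square)
    also have "(Im c)\<^sup>2 * ((cosh \<rho>)\<^sup>2 - 1) = (Im c * sinh \<rho>)\<^sup>2"
      by (simp add: sinh_square_eq power_mult_distrib)
    finally show ?thesis by (simp add: euclidean_circle_def)
  qed
  moreover have "z \<notin> hcircle c \<rho>" if "\<not> 0 < Im z" for z
    using that by (simp add: hcircle_def upper_half_plane_def)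
  ultimately show ?thesis using euclidean_circle_Im_pos[OF pos] by blast
qed

text \<open>Conversely, a Euclidean circle inside the half-plane with centre at height \<open>K\<close> and radius \<open>R\<close>
  is hyperbolic, with \<open>sqrt (K\<^sup>2 - R\<^sup>2)\<close> as the height of its hyperbolic centre. Tangency to
  geodesics can therefore be decided in Euclidean coordinates.\<close>

lemma hyperbolic_circle_iff_euclidean_circle:
  "(\<exists>c\<in>upper_half_plane. \<exists>\<rho>>0. C = hcircle c \<rho>) \<longleftrightarrow>
   (\<exists>m K R. 0 < R \<and> R < K \<and> C = euclidean_circle m K R)"
proof
  assume "\<exists>c\<in>upper_half_plane. \<exists>\<rho>>0. C = hcircle c \<rho>"
  then obtain c \<rho> where "0 < Im c" "0 < \<rho>" "C = hcircle c \<rho>"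
    by (auto simp: upper_half_plane_def)
  then show "\<exists>m K R. 0 < R \<and> R < K \<and> C = euclidean_circle m K R"
    by (intro exI[of _ "Re c"] exI[of _ "Im c * cosh \<rho>"] exI[of _ "Im c * sinh \<rho>"])
       (auto simp: hcircle_eq_euclidean_circle sinh_less_cosh_real)
next
  assume "\<exists>m K R. 0 < R \<and> R < K \<and> C = euclidean_circle m K R"
  then obtain m K R where *: "0 < R" "R < K" "C = euclidean_circle m K R" by blast
  have lt: "R\<^sup>2 < K\<^sup>2" using * by (simp add: power_strict_mono)
  define Y where "Y = sqrt (K\<^sup>2 - R\<^sup>2)"
  have Y: "0 < Y" "Y\<^sup>2 = K\<^sup>2 - R\<^sup>2" using lt by (auto simp: Y_def)
  define \<rho> where "\<rho> = arsinh (R / Y)"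
  have \<rho>: "sinh \<rho> = R / Y" by (simp add: \<rho>_def)
  have "0 < sinh \<rho>" using \<rho> Y * by simp
  then have "0 < \<rho>" by simp
  have "(Y * cosh \<rho>)\<^sup>2 = K\<^sup>2"
    using Y by (simp add: power_mult_distrib cosh_square_eq \<rho> power_divide field_simps)
  then have "Y * cosh \<rho> = K" using Y * by (simp add: power2_eq_iff_nonneg)
  then have "C = hcircle (Complex m Y) \<rho>"
    using * Y \<rho> \<open>0 < \<rho>\<close> by (simp add: hcircle_eq_euclidean_circle)
  then show "\<exists>c\<in>upper_half_plane. \<exists>\<rho>>0. C = hcircle c \<rho>"
    using Y \<open>0 < \<rho>\<close> by (intro bexI[of _ "Complex m Y"]) (auto simp: upper_half_plane_def)
qed

text \<open>The reflection in the horizontal line through the centre preserves both the circle and the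
  vertical line, so a single common point must lie on that horizontal line.\<close>

lemma circle_tangent_vertical_iff:
  assumes "0 < R" "R < K"
  shows "(\<exists>!z. z \<in> euclidean_circle m K R \<inter> geodesic (Some a) None) \<longleftrightarrow> \<bar>m - a\<bar> = R"
proof
  assume ex1: "\<exists>!z. z \<in> euclidean_circle m K R \<inter> geodesic (Some a) None"
  then obtain z where z: "z \<in> euclidean_circle m K R" "Re z = a"
    unfolding Int_iff mem_geodesic_Some_None by blast
  let ?z' = "Complex a (2 * K - Im z)"
  have "(2 * K - Im z - K)\<^sup>2 = (Im z - K)\<^sup>2" by (simp add: power2_eq_square algebra_simps)
  then have "?z' \<in> euclidean_circle m K R" using z by (simp add: euclidean_circle_def)
  then have "?z' \<in> euclidean_circle m K R \<inter> geodesic (Some a) None"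
    "z \<in> euclidean_circle m K R \<inter> geodesic (Some a) None"
    using z euclidean_circle_Im_pos[OF assms, of ?z' m] euclidean_circle_Im_pos[OF assms, of z m]
    unfolding Int_iff mem_geodesic_Some_None by auto
  then have "?z' = z" using ex1 by blast
  then have "Im ?z' = Im z" by (rule arg_cong)
  then have "Im z = K" by simp
  then have "(a - m)\<^sup>2 = R\<^sup>2" using z by (simp add: euclidean_circle_def)
  then show "\<bar>m - a\<bar> = R" using assms(1) by (auto simp: power2_eq_iff)
next
  assume R: "\<bar>m - a\<bar> = R"
  have "(a - m)\<^sup>2 = R\<^sup>2" unfolding R[symmetric] power2_abs by (rule power2_commute)
  then show "\<exists>!z. z \<in> euclidean_circle m K R \<inter> geodesic (Some a) None"
    using assms by (intro ex1I[of _ "Complex a K"])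
      (auto simp: euclidean_circle_def mem_geodesic_Some_None complex_eq_iff)
qed

text \<open>A circle touching two vertical sides has the radius of the semicircle and a centre right above
  that of the semicircle. Subtracting the two equations then gives \<open>Im z = K / 2\<close>, and the
  reflection in the vertical axis of symmetry forces a single common point to be the top of the
  semicircle.\<close>

lemma circle_tangent_semicircle_iff:
  assumes "0 < K" "a \<noteq> b"
  shows "(\<exists>!z. z \<in> euclidean_circle ((a + b) / 2) K (\<bar>b - a\<bar> / 2) \<inter> geodesic (Some a) (Some b))
    \<longleftrightarrow> K = \<bar>b - a\<bar>"
proof -
  define m R where "m = (a + b) / 2" and "R = \<bar>b - a\<bar> / 2"
  have R: "0 < R" using assms(2) by (simp add: R_def)
  have mem: "z \<in> euclidean_circle m K R \<inter> geodesic (Some a) (Some b)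
      \<longleftrightarrow> Im z = K / 2 \<and> (Re z - m)\<^sup>2 = R\<^sup>2 - (K / 2)\<^sup>2" for z
  proof -
    have "R\<^sup>2 = ((b - a) / 2)\<^sup>2" by (simp add: R_def power_divide)
    then have prod: "(Re z - a) * (Re z - b) = (Re z - m)\<^sup>2 - R\<^sup>2"
      by (simp add: m_def power2_eq_square field_simps)
    have "z \<in> euclidean_circle m K R \<inter> geodesic (Some a) (Some b) \<longleftrightarrow>
        0 < Im z \<and> (Re z - m)\<^sup>2 + (Im z - K)\<^sup>2 = R\<^sup>2 \<and> (Re z - m)\<^sup>2 + (Im z)\<^sup>2 = R\<^sup>2"
      unfolding Int_iff mem_geodesic_Some_Some euclidean_circle_def mem_Collect_eq prod by auto
    also have "\<dots> \<longleftrightarrow> 0 < Im z \<and> (Im z - K)\<^sup>2 = (Im z)\<^sup>2 \<and> (Re z - m)\<^sup>2 + (Im z)\<^sup>2 = R\<^sup>2"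
      by auto
    also have "(Im z - K)\<^sup>2 = (Im z)\<^sup>2 \<longleftrightarrow> Im z = K / 2"
      using assms(1) by (auto simp: power2_eq_iff)
    finally show ?thesis using assms(1) by auto
  qed
  have "(\<exists>!z. z \<in> euclidean_circle m K R \<inter> geodesic (Some a) (Some b)) \<longleftrightarrow> K = 2 * R"
  proof
    assume ex1: "\<exists>!z. z \<in> euclidean_circle m K R \<inter> geodesic (Some a) (Some b)"
    then obtain z where z: "Im z = K / 2" "(Re z - m)\<^sup>2 = R\<^sup>2 - (K / 2)\<^sup>2"
      unfolding mem by blast
    let ?z' = "Complex (2 * m - Re z) (Im z)"
    have "(2 * m - Re z - m)\<^sup>2 = (Re z - m)\<^sup>2" by (simp add: power2_eq_square algebra_simps)
    then have "?z' \<in> euclidean_circle m K R \<inter> geodesic (Some a) (Some b)"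
      using z unfolding mem by simp
    moreover have "z \<in> euclidean_circle m K R \<inter> geodesic (Some a) (Some b)"
      using z unfolding mem by simp
    ultimately have "?z' = z" using ex1 by blast
    then have "Re ?z' = Re z" by (rule arg_cong)
    then have "Re z = m" by simp
    then have "(K / 2)\<^sup>2 = R\<^sup>2" using z(2) by simp
    then have "K / 2 = R" using assms(1) R by (subst (asm) power2_eq_iff_nonneg) simp_all
    then show "K = 2 * R" by simp
  next
    assume "K = 2 * R"
    then have "z \<in> euclidean_circle m K R \<inter> geodesic (Some a) (Some b) \<longleftrightarrow> z = Complex m R" for z
      unfolding mem by (auto simp: complex_eq_iff)
    then show "\<exists>!z. z \<in> euclidean_circle m K R \<inter> geodesic (Some a) (Some b)" by simp
  qed
  then show ?thesis by (simp add: m_def R_def)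
qed

text \<open>The property that characterises the inscribed circle, as a predicate that can be transported by
  isometries.\<close>

definition tritangent :: "ideal_point \<Rightarrow> ideal_point \<Rightarrow> ideal_point \<Rightarrow> complex set \<Rightarrow> bool" where
  "tritangent p q r C \<longleftrightarrow>
     (\<exists>c\<in>upper_half_plane. \<exists>\<rho>>0. C = hcircle c \<rho>) \<and>
     (\<exists>!z. z \<in> C \<inter> geodesic p q) \<and> (\<exists>!z. z \<in> C \<inter> geodesic q r) \<and> (\<exists>!z. z \<in> C \<inter> geodesic r p)"

lemma inscribed_circle_eqI:
  assumes "\<And>D. tritangent p q r D \<longleftrightarrow> D = C"
  shows "inscribed_circle p q r = C"
  using assms unfolding inscribed_circle_def tritangent_def[symmetric] by simp

text \<open>Tangency to the vertical sides fixes the radius and the real part of the centre; tangency to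
  the semicircle then fixes the height.\<close>

lemma tritangent_at_infinity_iff:
  assumes "a \<noteq> b"
  shows "tritangent (Some b) None (Some a) C \<longleftrightarrow>
    C = euclidean_circle ((a + b) / 2) \<bar>b - a\<bar> (\<bar>b - a\<bar> / 2)" (is "_ \<longleftrightarrow> _ = ?C")
proof
  assume T: "tritangent (Some b) None (Some a) C"
  then have "\<exists>m K R. 0 < R \<and> R < K \<and> C = euclidean_circle m K R"
    unfolding tritangent_def hyperbolic_circle_iff_euclidean_circle by (rule conjunct1)
  then obtain m K R where R: "0 < R" "R < K" and C: "C = euclidean_circle m K R" by blast
  have *: "(\<exists>!z. z \<in> C \<inter> geodesic (Some b) None) \<and> (\<exists>!z. z \<in> C \<inter> geodesic (Some a) None) \<and>
    (\<exists>!z. z \<in> C \<inter> geodesic (Some a) (Some b))"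
    using T unfolding tritangent_def geodesic_commute[of None "Some a"] by (rule conjunct2)
  have "\<bar>m - b\<bar> = R" "\<bar>m - a\<bar> = R"
    using * unfolding C circle_tangent_vertical_iff[OF R] by simp_all
  then have "m - b = m - a \<or> m - b = - (m - a)" by (simp only: abs_eq_iff[symmetric])
  then have "m - b = - (m - a)" using assms by simp
  then have "m = (a + b) / 2" by simp
  moreover from this have "m - b = - ((b - a) / 2)" by (simp add: field_simps)
  with \<open>\<bar>m - b\<bar> = R\<close> have "R = \<bar>b - a\<bar> / 2" by simp
  ultimately have m: "m = (a + b) / 2" "R = \<bar>b - a\<bar> / 2" .
  have "0 < K" using R by linarith
  then have "K = \<bar>b - a\<bar>"
    using conjunct2[OF conjunct2[OF *]] unfolding C m
    by (simp only: circle_tangent_semicircle_iff[OF _ assms])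
  then show "C = ?C" using C m by simp
next
  assume C: "C = ?C"
  have mid: "(a + b) / 2 - b = - ((b - a) / 2)" "(a + b) / 2 - a = (b - a) / 2"
    by (simp_all add: field_simps)
  have m: "\<bar>(a + b) / 2 - b\<bar> = \<bar>b - a\<bar> / 2" "\<bar>(a + b) / 2 - a\<bar> = \<bar>b - a\<bar> / 2"
    unfolding mid by simp_all
  have pos: "0 < \<bar>b - a\<bar> / 2" "\<bar>b - a\<bar> / 2 < \<bar>b - a\<bar>" using assms by simp_all
  have "\<exists>!z. z \<in> ?C \<inter> geodesic (Some b) None" "\<exists>!z. z \<in> ?C \<inter> geodesic (Some a) None"
    unfolding circle_tangent_vertical_iff[OF pos] by (rule m)+
  moreover have "\<exists>!z. z \<in> ?C \<inter> geodesic (Some a) (Some b)"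
    using assms by (subst circle_tangent_semicircle_iff) auto
  moreover have "\<exists>m K R. 0 < R \<and> R < K \<and> ?C = euclidean_circle m K R"
    using pos by blast
  ultimately show "tritangent (Some b) None (Some a) C"
    unfolding tritangent_def hyperbolic_circle_iff_euclidean_circle geodesic_commute[of None "Some a"] C
    by (intro conjI)
qed

lemma tangency_point_at_infinity:
  assumes "a \<noteq> b"
  shows "tangency_point (Some b) None (Some a) = Complex b \<bar>b - a\<bar>"
proof -
  have "inscribed_circle (Some b) None (Some a) =
      euclidean_circle ((a + b) / 2) \<bar>b - a\<bar> (\<bar>b - a\<bar> / 2)"
    by (rule inscribed_circle_eqI) (rule tritangent_at_infinity_iff[OF assms])
  moreover have "(b - (a + b) / 2)\<^sup>2 = (\<bar>b - a\<bar> / 2)\<^sup>2"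
    by (simp add: power_divide) (simp add: field_simps power2_eq_square)
  ultimately show ?thesis
    unfolding tangency_point_def using assms
    by (intro the_equality)
      (auto simp: euclidean_circle_def mem_geodesic_Some_None complex_eq_iff)
qed

text \<open>The tangency points lie on the vertical line above \<open>b\<close> at the heights \<open>b - a\<close> and \<open>c - b\<close>.\<close>

lemma shear_at_infinity:
  assumes "a < b" "b < c"
  shows "shear (Some b) None (Some a) (Some c) = ln ((c - b) / (b - a))"
proof -
  have "shear (Some b) None (Some a) (Some c) =
      (if b - a \<le> c - b then \<bar>ln ((c - b) / (b - a))\<bar> else - \<bar>ln ((c - b) / (b - a))\<bar>)"
    using assms by (simp add: shear_def signed_dist_def tangency_point_at_infinity hdist_vertical)
  also have "\<dots> = ln ((c - b) / (b - a))"
  proof (cases "b - a \<le> c - b")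
    case True
    then have "0 \<le> ln ((c - b) / (b - a))" using assms by (intro ln_ge_zero) (simp add: field_simps)
    then show ?thesis using True by simp
  next
    case False
    then have "ln ((c - b) / (b - a)) \<le> 0" using assms by (subst ln_le_zero_iff) (auto simp: field_simps)
    then show ?thesis using False by simp
  qed
  finally show ?thesis .
qed

section \<open>Transport to infinity of a finite ideal vertex\<close>

text \<open>An orientation-preserving isometry of the half-plane sending the ideal point \<open>y\<close> to \<open>\<infinity>\<close> and any
  other real ideal point \<open>a\<close> to \<open>- 1 / (a - y)\<close>.\<close>

definition to_infinity :: "real \<Rightarrow> complex \<Rightarrow> complex" where
  "to_infinity y z = - 1 / (z - complex_of_real y)"

lemma to_infinity_ne: "0 < Im z \<Longrightarrow> z - complex_of_real y \<noteq> 0"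
  by (auto simp: complex_eq_iff)

lemma Im_to_infinity: "Im (to_infinity y z) = Im z / (cmod (z - complex_of_real y))\<^sup>2"
  by (simp add: to_infinity_def Im_divide cmod_power2)

lemma Re_to_infinity: "Re (to_infinity y z) = (y - Re z) / (cmod (z - complex_of_real y))\<^sup>2"
  by (simp add: to_infinity_def Re_divide cmod_power2)
    (simp only: minus_divide_left minus_diff_eq)

lemma Im_to_infinity_pos: "0 < Im z \<Longrightarrow> 0 < Im (to_infinity y z)"
  using to_infinity_ne[of z y] by (simp add: Im_to_infinity)

lemma bij_to_infinity: "bij_betw (to_infinity y) upper_half_plane upper_half_plane"
proof (rule bij_betw_byWitness[where f' = "\<lambda>w. complex_of_real y - 1 / w"])
  show "\<forall>z\<in>upper_half_plane. complex_of_real y - 1 / to_infinity y z = z"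
    using to_infinity_ne by (auto simp: upper_half_plane_def to_infinity_def)
  show "\<forall>w\<in>upper_half_plane. to_infinity y (complex_of_real y - 1 / w) = w"
    by (auto simp: upper_half_plane_def to_infinity_def)
  show "to_infinity y ` upper_half_plane \<subseteq> upper_half_plane"
    using Im_to_infinity_pos by (auto simp: upper_half_plane_def)
  show "(\<lambda>w. complex_of_real y - 1 / w) ` upper_half_plane \<subseteq> upper_half_plane"
    by (auto simp: upper_half_plane_def Im_divide complex_eq_iff sum_power2_gt_zero_iff)
qed

lemma hdist_to_infinity:
  assumes "0 < Im z" "0 < Im w"
  shows "hdist (to_infinity y z) (to_infinity y w) = hdist z w"
proof -
  let ?z = "z - complex_of_real y" and ?w = "w - complex_of_real y"
  have nz: "?z \<noteq> 0" "?w \<noteq> 0" using assms to_infinity_ne by blast+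
  have "to_infinity y z - to_infinity y w = (z - w) / (?z * ?w)"
    using nz by (simp add: to_infinity_def field_simps)
  then have "cmod (to_infinity y z - to_infinity y w) = cmod (z - w) / (cmod ?z * cmod ?w)"
    by (simp add: norm_divide norm_mult)
  then show ?thesis
    using nz unfolding hdist_def Im_to_infinity
    by (simp add: power_divide power_mult_distrib)
qed

lemma to_infinity_mem_vertical_iff:
  assumes "0 < Im z" "a \<noteq> y"
  shows "to_infinity y z \<in> geodesic (Some (- 1 / (a - y))) None \<longleftrightarrow> z \<in> geodesic (Some a) (Some y)"
proof -
  let ?N = "(Re z - y)\<^sup>2 + (Im z)\<^sup>2"
  have N: "0 < ?N" using assms by (simp add: sum_power2_gt_zero_iff)
  have "Re (to_infinity y z) = - 1 / (a - y) \<longleftrightarrow> (Re z - y) * (a - y) = ?N"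
  proof -
    have "Re (to_infinity y z) = - 1 / (a - y) \<longleftrightarrow> (y - Re z) * (a - y) = - 1 * ?N"
      unfolding Re_to_infinity cmod_power2 using N assms(2) by (subst frac_eq_eq) auto
    then show ?thesis by (auto simp: algebra_simps)
  qed
  also have "\<dots> \<longleftrightarrow> (Re z - a) * (Re z - y) + (Im z)\<^sup>2 = 0"
    by (auto simp: power2_eq_square algebra_simps)
  finally show ?thesis
    using assms Im_to_infinity_pos[OF assms(1)]
    by (simp add: mem_geodesic_Some_None mem_geodesic_Some_Some)
qed

lemma to_infinity_mem_semicircle_iff:
  assumes "0 < Im z" "a \<noteq> y" "b \<noteq> y"
  shows "to_infinity y z \<in> geodesic (Some (- 1 / (a - y))) (Some (- 1 / (b - y))) \<longleftrightarrow>
    z \<in> geodesic (Some a) (Some b)"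
proof -
  define X V A B where "X = Re z - y" and "V = Im z" and "A = a - y" and "B = b - y"
  define N where "N = X\<^sup>2 + V\<^sup>2"
  have N: "0 < N" and nz: "A \<noteq> 0" "B \<noteq> 0"
    using assms by (auto simp: N_def V_def A_def B_def sum_power2_gt_zero_iff)
  have re: "Re (to_infinity y z) = - X / N" and im: "Im (to_infinity y z) = V / N"
    by (simp_all add: Re_to_infinity Im_to_infinity cmod_power2 N_def X_def V_def)
  have "(- X / N - - 1 / A) * (- X / N - - 1 / B) + (V / N)\<^sup>2 =
      ((N - A * X) * (N - B * X) + A * B * V\<^sup>2) / (A * B * N\<^sup>2)"
    using N nz by (simp add: field_simps power2_eq_square)
  also have "(N - A * X) * (N - B * X) + A * B * V\<^sup>2 = N * ((X - A) * (X - B) + V\<^sup>2)"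
    unfolding N_def by (simp add: algebra_simps power2_eq_square)
  finally have "(- X / N - - 1 / A) * (- X / N - - 1 / B) + (V / N)\<^sup>2 = 0 \<longleftrightarrow>
      (X - A) * (X - B) + V\<^sup>2 = 0"
    using N nz by simp
  moreover have "X - A = Re z - a" "X - B = Re z - b" by (simp_all add: X_def A_def B_def)
  ultimately show ?thesis
    using assms(1) Im_to_infinity_pos[OF assms(1)]
    unfolding mem_geodesic_Some_Some re im A_def[symmetric] B_def[symmetric]
    using N by (simp add: V_def)
qed

lemma ex1_image_inter_iff:
  assumes "inj_on f U" "C \<subseteq> U" "\<And>z. z \<in> U \<Longrightarrow> f z \<in> G' \<longleftrightarrow> z \<in> G"
  shows "(\<exists>!w. w \<in> f ` C \<inter> G') \<longleftrightarrow> (\<exists>!z. z \<in> C \<inter> G)"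
proof -
  have "f ` C \<inter> G' = f ` (C \<inter> G)" using assms(2,3) by blast
  moreover have "inj_on f (C \<inter> G)" using assms(1,2) by (meson inf.coboundedI1 inj_on_subset)
  moreover have "(\<exists>!w. w \<in> f ` S) \<longleftrightarrow> (\<exists>!z. z \<in> S)" if "inj_on f S" for S
  proof
    assume ex1: "\<exists>!w. w \<in> f ` S"
    then obtain z where "z \<in> S" by blast
    then show "\<exists>!z. z \<in> S"
      using ex1 that by (intro ex1I[of _ z]) (blast dest: inj_onD)+
  qed blast
  ultimately show ?thesis by simp
qed

lemma hcircle_subset: "hcircle c \<rho> \<subseteq> upper_half_plane"
  by (auto simp: hcircle_def)

lemma to_infinity_hcircle:
  assumes "0 < Im c"
  shows "to_infinity y ` hcircle c \<rho> = hcircle (to_infinity y c) \<rho>"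
proof -
  have mem: "to_infinity y z \<in> hcircle (to_infinity y c) \<rho> \<longleftrightarrow> z \<in> hcircle c \<rho>"
    if "z \<in> upper_half_plane" for z
    using that assms
    by (simp add: hcircle_def upper_half_plane_def hdist_to_infinity Im_to_infinity_pos)
  have surj: "to_infinity y ` upper_half_plane = upper_half_plane"
    using bij_to_infinity by (simp add: bij_betw_def)
  show ?thesis
  proof
    show "to_infinity y ` hcircle c \<rho> \<subseteq> hcircle (to_infinity y c) \<rho>"
      using mem hcircle_subset by blast
    show "hcircle (to_infinity y c) \<rho> \<subseteq> to_infinity y ` hcircle c \<rho>"
    proof
      fix w assume w: "w \<in> hcircle (to_infinity y c) \<rho>"
      then have "w \<in> to_infinity y ` upper_half_plane" using hcircle_subset surj by blast
      then obtain z where "z \<in> upper_half_plane" "w = to_infinity y z" by blast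
      then show "w \<in> to_infinity y ` hcircle c \<rho>" using mem w by blast
    qed
  qed
qed

text \<open>The isometry maps hyperbolic circles to hyperbolic circles and the sides of the triangle to the
  sides of the image triangle, and being injective it preserves the number of common points.\<close>

lemma tritangent_to_infinity_iff:
  assumes "C \<subseteq> upper_half_plane" "a \<noteq> y" "b \<noteq> y"
  shows "tritangent (Some (- 1 / (a - y))) None (Some (- 1 / (b - y))) (to_infinity y ` C)
    \<longleftrightarrow> tritangent (Some a) (Some y) (Some b) C"
proof -
  let ?f = "to_infinity y"
  have inj: "inj_on ?f upper_half_plane" and surj: "?f ` upper_half_plane = upper_half_plane"
    using bij_to_infinity by (auto simp: bij_betw_def)
  have "(\<exists>c\<in>upper_half_plane. \<exists>\<rho>>0. ?f ` C = hcircle c \<rho>) \<longleftrightarrow>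
      (\<exists>c\<in>?f ` upper_half_plane. \<exists>\<rho>>0. ?f ` C = hcircle c \<rho>)" by (simp only: surj)
  also have "\<dots> \<longleftrightarrow> (\<exists>c\<in>upper_half_plane. \<exists>\<rho>>0. ?f ` C = hcircle (?f c) \<rho>)" by (rule bex_simps(7))
  also have "\<dots> \<longleftrightarrow> (\<exists>c\<in>upper_half_plane. \<exists>\<rho>>0. ?f ` C = ?f ` hcircle c \<rho>)"
    by (rule bex_cong) (simp_all add: to_infinity_hcircle upper_half_plane_def)
  also have "\<dots> \<longleftrightarrow> (\<exists>c\<in>upper_half_plane. \<exists>\<rho>>0. C = hcircle c \<rho>)"
    using inj_on_image_eq_iff[OF inj assms(1) hcircle_subset] by simp
  finally have 1: "(\<exists>c\<in>upper_half_plane. \<exists>\<rho>>0. ?f ` C = hcircle c \<rho>) \<longleftrightarrow>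
      (\<exists>c\<in>upper_half_plane. \<exists>\<rho>>0. C = hcircle c \<rho>)" .
  have 2: "(\<exists>!w. w \<in> ?f ` C \<inter> geodesic (Some (- 1 / (a - y))) None) \<longleftrightarrow>
      (\<exists>!z. z \<in> C \<inter> geodesic (Some a) (Some y))"
    by (rule ex1_image_inter_iff[OF inj assms(1)], rule to_infinity_mem_vertical_iff)
      (use assms in \<open>auto simp: upper_half_plane_def\<close>)
  have 3: "(\<exists>!w. w \<in> ?f ` C \<inter> geodesic (Some (- 1 / (b - y))) None) \<longleftrightarrow>
      (\<exists>!z. z \<in> C \<inter> geodesic (Some b) (Some y))"
    by (rule ex1_image_inter_iff[OF inj assms(1)], rule to_infinity_mem_vertical_iff)
      (use assms in \<open>auto simp: upper_half_plane_def\<close>)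
  have 4: "(\<exists>!w. w \<in> ?f ` C \<inter> geodesic (Some (- 1 / (b - y))) (Some (- 1 / (a - y)))) \<longleftrightarrow>
      (\<exists>!z. z \<in> C \<inter> geodesic (Some b) (Some a))"
    by (rule ex1_image_inter_iff[OF inj assms(1)], rule to_infinity_mem_semicircle_iff)
      (use assms in \<open>auto simp: upper_half_plane_def\<close>)
  show ?thesis
    unfolding tritangent_def geodesic_commute[of None] geodesic_commute[of "Some y"] 1 2 3 4 ..
qed

text \<open>The inscribed circle is the preimage of the unique one for the image triangle, whose tangency
  point is explicit. Only the image of the tangency point is recorded: it suffices to tell two
  tangency points on the same side apart.\<close>

lemma tangency_point_finite:
  assumes "a \<noteq> y" "b \<noteq> y" "a \<noteq> b"
  shows "tangency_point (Some a) (Some y) (Some b) \<in> upper_half_plane"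
    and "to_infinity y (tangency_point (Some a) (Some y) (Some b)) =
      Complex (- 1 / (a - y)) \<bar>1 / (b - y) - 1 / (a - y)\<bar>"
proof -
  let ?f = "to_infinity y" and ?a = "- 1 / (a - y)" and ?b = "- 1 / (b - y)"
  let ?C = "euclidean_circle ((?b + ?a) / 2) \<bar>?a - ?b\<bar> (\<bar>?a - ?b\<bar> / 2)"
  have ne: "?b \<noteq> ?a" using assms by (simp add: field_simps)
  have inj: "inj_on ?f upper_half_plane" and surj: "?f ` upper_half_plane = upper_half_plane"
    using bij_to_infinity by (auto simp: bij_betw_def)
  have T: "tritangent (Some ?a) None (Some ?b) D \<longleftrightarrow> D = ?C" for D
    by (rule tritangent_at_infinity_iff[OF ne])
  have "?C \<subseteq> upper_half_plane"
    using euclidean_circle_Im_pos[of "\<bar>?a - ?b\<bar> / 2" "\<bar>?a - ?b\<bar>"] ne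
    by (auto simp: upper_half_plane_def)
  then obtain C where C: "C \<subseteq> upper_half_plane" "?f ` C = ?C" by (metis subset_image_iff surj)
  have inscribed: "inscribed_circle (Some a) (Some y) (Some b) = C"
  proof (rule inscribed_circle_eqI)
    fix D
    show "tritangent (Some a) (Some y) (Some b) D \<longleftrightarrow> D = C"
    proof
      assume D: "tritangent (Some a) (Some y) (Some b) D"
      then have sub: "D \<subseteq> upper_half_plane" unfolding tritangent_def using hcircle_subset by auto
      then have "?f ` D = ?f ` C"
        using D tritangent_to_infinity_iff[OF sub assms(1,2)] T C by simp
      then show "D = C" using inj_on_image_eq_iff[OF inj sub C(1)] by simp
    next
      assume "D = C"
      then show "tritangent (Some a) (Some y) (Some b) D"
        using tritangent_to_infinity_iff[OF C(1) assms(1,2)] T C by simp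
    qed
  qed
  have "tritangent (Some a) (Some y) (Some b) C"
    using tritangent_to_infinity_iff[OF C(1) assms(1,2)] T C by simp
  then have "\<exists>!z. z \<in> C \<inter> geodesic (Some a) (Some y)"
    unfolding tritangent_def by (rule conjunct1[OF conjunct2])
  then have mem: "tangency_point (Some a) (Some y) (Some b) \<in> C \<inter> geodesic (Some a) (Some y)"
    unfolding tangency_point_def inscribed by (rule theI')
  then show U: "tangency_point (Some a) (Some y) (Some b) \<in> upper_half_plane" using C by blast
  have "?f (tangency_point (Some a) (Some y) (Some b)) \<in> ?C \<inter> geodesic (Some ?a) None"
    using mem U C(2) to_infinity_mem_vertical_iff[OF _ assms(1)]
    by (auto simp: upper_half_plane_def)
  moreover have "(?a - (?b + ?a) / 2)\<^sup>2 = (\<bar>?a - ?b\<bar> / 2)\<^sup>2"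
    by (simp only: power_divide power2_abs) (simp add: field_simps power2_eq_square)
  ultimately show "?f (tangency_point (Some a) (Some y) (Some b)) = 
      Complex ?a \<bar>1 / (b - y) - 1 / (a - y)\<bar>"
    by (auto simp: euclidean_circle_def mem_geodesic_Some_None complex_eq_iff)
qed

section \<open>Lambda lengths\<close>

lemma mem_horocycle_Some:
  assumes "0 < t"
  shows "z \<in> horocycle (Some a) t \<longleftrightarrow> 0 < Im z \<and> (Re z - a)\<^sup>2 + (Im z)\<^sup>2 = t * Im z"
proof -
  have "cmod (z - Complex a (t / 2)) = t / 2 \<longleftrightarrow> (cmod (z - Complex a (t / 2)))\<^sup>2 = (t / 2)\<^sup>2"
    using assms by (intro power2_eq_iff_nonneg[symmetric]) auto
  also have "\<dots> \<longleftrightarrow> (Re z - a)\<^sup>2 + (Im z)\<^sup>2 = t * Im z"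
    unfolding cmod_power2 by (auto simp: field_simps power2_eq_square)
  finally show ?thesis by (simp add: upper_half_plane_def)
qed

lemma mem_horodisk_Some:
  assumes "0 < t"
  shows "z \<in> horodisk (Some a) t \<longleftrightarrow> 0 < Im z \<and> (Re z - a)\<^sup>2 + (Im z)\<^sup>2 < t * Im z"
proof -
  have "cmod (z - Complex a (t / 2)) < t / 2 \<longleftrightarrow> (cmod (z - Complex a (t / 2)))\<^sup>2 < (t / 2)\<^sup>2"
    using assms power2_less_imp_less[of "cmod (z - Complex a (t / 2))" "t / 2"]
      power_strict_mono[of "cmod (z - Complex a (t / 2))" "t / 2" 2] by auto
  also have "\<dots> \<longleftrightarrow> (Re z - a)\<^sup>2 + (Im z)\<^sup>2 < t * Im z"
    unfolding cmod_power2 by (auto simp: field_simps power2_eq_square)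
  finally show ?thesis by (simp add: upper_half_plane_def)
qed

text \<open>The sign that distinguishes disjoint from overlapping horodisks agrees with the sign of
  \<open>ln r\<close>, so both cases give the same formula for the lambda length.\<close>

lemma lambda_length_squared_eqI:
  assumes "0 < r"
    and "horocycle_dist d p q = (if 1 \<le> r then \<bar>ln r\<bar> else - \<bar>ln r\<bar>)"
  shows "(lambda_length d p q)\<^sup>2 = r"
proof -
  have "horocycle_dist d p q = ln r"
    using assms by (auto simp: abs_if)
  then show ?thesis using assms(1) by (simp add: lambda_length_def)
qed

lemma lambda_length_squared_vertical:
  assumes "0 < d (Some a)" "0 < d None"
  shows "(lambda_length d (Some a) None)\<^sup>2 = d None / d (Some a)"
proof (rule lambda_length_squared_eqI)
  let ?t = "d (Some a)" and ?H = "d None"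
  show "0 < ?H / ?t" using assms by simp
  have x: "(THE z. z \<in> geodesic (Some a) None \<inter> horocycle (Some a) ?t) = Complex a ?t"
    using assms unfolding Int_iff mem_geodesic_Some_None mem_horocycle_Some[OF assms(1)]
    by (intro the_equality) (auto simp: complex_eq_iff power2_eq_square)
  have y: "(THE z. z \<in> geodesic (Some a) None \<inter> horocycle None ?H) = Complex a ?H"
    using assms by (intro the_equality) (auto simp: complex_eq_iff upper_half_plane_def geodesic.simps)
  have "horodisk (Some a) ?t \<inter> horodisk None ?H = {} \<longleftrightarrow> 1 \<le> ?H / ?t"
  proof
    assume disj: "horodisk (Some a) ?t \<inter> horodisk None ?H = {}"
    show "1 \<le> ?H / ?t"
    proof (rule ccontr)
      assume "\<not> 1 \<le> ?H / ?t"
      then have "?H < ?t" using assms by (simp add: field_simps)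
      then obtain v where "?H < v" "v < ?t" using dense by blast
      then have "Complex a v \<in> horodisk (Some a) ?t \<inter> horodisk None ?H"
        unfolding Int_iff mem_horodisk_Some[OF assms(1)]
        using assms by (auto simp: upper_half_plane_def power2_eq_square)
      then show False using disj by blast
    qed
  next
    assume "1 \<le> ?H / ?t"
    then have le: "?t \<le> ?H" using assms by (simp add: field_simps)
    have False if "z \<in> horodisk (Some a) ?t" "z \<in> horodisk None ?H" for z
    proof -
      have "0 < Im z" "(Im z)\<^sup>2 < ?t * Im z"
        using that(1) unfolding mem_horodisk_Some[OF assms(1)]
        by (auto intro: le_less_trans[rotated])
      then have "Im z < ?t" by (simp add: power2_eq_square)
      then show False using that(2) le by simp
    qed
    then show "horodisk (Some a) ?t \<inter> horodisk None ?H = {}" by blast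
  qed
  then show "horocycle_dist d (Some a) None =
      (if 1 \<le> ?H / ?t then \<bar>ln (?H / ?t)\<bar> else - \<bar>ln (?H / ?t)\<bar>)"
    unfolding horocycle_dist_def Let_def x y using assms by (simp add: hdist_vertical)
qed

text \<open>Subtracting the equations of the semicircle and of the horocycle leaves the line
  \<open>(Re z - a) * L = t * Im z\<close> through \<open>a\<close>, on which the point other than \<open>a\<close> is found.\<close>

lemma geodesic_inter_horocycle:
  assumes "0 < t" "a \<noteq> b"
  defines "L \<equiv> b - a"
  shows "(THE z. z \<in> geodesic (Some a) (Some b) \<inter> horocycle (Some a) t) =
    Complex (a + t\<^sup>2 * L / (t\<^sup>2 + L\<^sup>2)) (t * L\<^sup>2 / (t\<^sup>2 + L\<^sup>2))"
    (is "_ = ?z")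
proof -
  have L: "L \<noteq> 0" using assms by simp
  have N: "0 < t\<^sup>2 + L\<^sup>2" using assms(1) by (simp add: sum_power2_gt_zero_iff)
  have "z \<in> geodesic (Some a) (Some b) \<inter> horocycle (Some a) t \<longleftrightarrow> z = ?z" for z
  proof -
    define X V where "X = Re z - a" and "V = Im z"
    have "z \<in> geodesic (Some a) (Some b) \<inter> horocycle (Some a) t \<longleftrightarrow>
        0 < V \<and> X * (X - L) + V\<^sup>2 = 0 \<and> X\<^sup>2 + V\<^sup>2 = t * V"
      unfolding Int_iff mem_geodesic_Some_Some mem_horocycle_Some[OF assms(1)]
      by (auto simp: X_def V_def L_def)
    also have "\<dots> \<longleftrightarrow> 0 < V \<and> X * L = t * V \<and> X\<^sup>2 + V\<^sup>2 = t * V"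
      by (auto simp: power2_eq_square algebra_simps)
    also have "\<dots> \<longleftrightarrow> X = t\<^sup>2 * L / (t\<^sup>2 + L\<^sup>2) \<and> V = t * L\<^sup>2 / (t\<^sup>2 + L\<^sup>2)"
    proof
      assume *: "0 < V \<and> X * L = t * V \<and> X\<^sup>2 + V\<^sup>2 = t * V"
      then have "(X * L)\<^sup>2 = (t * V)\<^sup>2" "(X\<^sup>2 + V\<^sup>2) * L\<^sup>2 = t * V * L\<^sup>2" by simp_all
      then have "V * (V * (t\<^sup>2 + L\<^sup>2)) = V * (t * L\<^sup>2)"
        by (simp add: power2_eq_square algebra_simps)
      then have "V * (t\<^sup>2 + L\<^sup>2) = t * L\<^sup>2" using * by simp
      then have V: "V = t * L\<^sup>2 / (t\<^sup>2 + L\<^sup>2)" using N by (subst nonzero_eq_divide_eq) auto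
      have "X = t * V / L" using * L by (simp add: field_simps)
      then have "X = t\<^sup>2 * L / (t\<^sup>2 + L\<^sup>2)" using L unfolding V by (simp add: power2_eq_square)
      with V show "X = t\<^sup>2 * L / (t\<^sup>2 + L\<^sup>2) \<and> V = t * L\<^sup>2 / (t\<^sup>2 + L\<^sup>2)" by simp
    next
      assume *: "X = t\<^sup>2 * L / (t\<^sup>2 + L\<^sup>2) \<and> V = t * L\<^sup>2 / (t\<^sup>2 + L\<^sup>2)"
      have "X\<^sup>2 + V\<^sup>2 = t\<^sup>2 * L\<^sup>2 * (t\<^sup>2 + L\<^sup>2) / (t\<^sup>2 + L\<^sup>2)\<^sup>2"
        unfolding conjunct1[OF *] conjunct2[OF *] power_divide add_divide_distrib[symmetric]
        by (simp add: algebra_simps power2_eq_square)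
      also have "\<dots> = t * V" using N * by (simp add: power2_eq_square)
      finally have "X\<^sup>2 + V\<^sup>2 = t * V" .
      moreover have "0 < V" unfolding conjunct2[OF *] using N L assms(1) by simp
      moreover have "X * L = t * V" using * by (simp add: power2_eq_square)
      ultimately show "0 < V \<and> X * L = t * V \<and> X\<^sup>2 + V\<^sup>2 = t * V"
        by simp
    qed
    also have "\<dots> \<longleftrightarrow> z = ?z" by (auto simp: complex_eq_iff X_def V_def)
    finally show ?thesis .
  qed
  then show ?thesis by simp
qed

text \<open>The two Euclidean disks are tangent when the squared distance of the centres,
  \<open>(b - a)\<^sup>2 + ((t - u) / 2)\<^sup>2\<close>, equals \<open>((t + u) / 2)\<^sup>2\<close>, that is, when \<open>t * u = (b - a)\<^sup>2\<close>.\<close>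

lemma horodisks_disjoint_iff:
  assumes "0 < t" "0 < u"
  shows "horodisk (Some a) t \<inter> horodisk (Some b) u = {} \<longleftrightarrow> t * u \<le> (b - a)\<^sup>2"
proof
  assume disj: "horodisk (Some a) t \<inter> horodisk (Some b) u = {}"
  show "t * u \<le> (b - a)\<^sup>2"
  proof (rule ccontr)
    assume "\<not> t * u \<le> (b - a)\<^sup>2"
    then have lt: "(b - a)\<^sup>2 < t * u" by simp
    let ?L = "b - a" and ?S = "t + u"
    \<comment> \<open>the point dividing the segment between the centres in the ratio of the radii\<close>
    let ?z = "Complex (a + t * ?L / ?S) (t * u / ?S)"
    have S: "0 < ?S" using assms by simp
    have "(t * ?L / ?S)\<^sup>2 + (t * u / ?S)\<^sup>2 = (t\<^sup>2 * ?L\<^sup>2 + t\<^sup>2 * u\<^sup>2) / ?S\<^sup>2"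
      by (simp add: power_divide power_mult_distrib add_divide_distrib)
    also have "\<dots> < (t\<^sup>2 * (t * u) + t\<^sup>2 * u\<^sup>2) / ?S\<^sup>2"
      using lt assms S by (intro divide_strict_right_mono) auto
    also have "t\<^sup>2 * (t * u) + t\<^sup>2 * u\<^sup>2 = t * (t * u) * ?S"
      by (simp add: power2_eq_square algebra_simps)
    also have "t * (t * u) * ?S / ?S\<^sup>2 = t * (t * u / ?S)"
      using S by (simp add: power2_eq_square)
    finally have 1: "?z \<in> horodisk (Some a) t"
      unfolding mem_horodisk_Some[OF assms(1)] using assms S by simp
    have eq: "a + t * ?L / ?S - b = - (u * ?L / ?S)" using S by (simp add: field_simps)
    have "(u * ?L / ?S)\<^sup>2 + (t * u / ?S)\<^sup>2 = (u\<^sup>2 * ?L\<^sup>2 + t\<^sup>2 * u\<^sup>2) / ?S\<^sup>2"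
      by (simp add: power_divide power_mult_distrib add_divide_distrib)
    also have "\<dots> < (u\<^sup>2 * (t * u) + t\<^sup>2 * u\<^sup>2) / ?S\<^sup>2"
      using lt assms S by (intro divide_strict_right_mono) auto
    also have "u\<^sup>2 * (t * u) + t\<^sup>2 * u\<^sup>2 = u * (t * u) * ?S"
      by (simp add: power2_eq_square algebra_simps)
    also have "u * (t * u) * ?S / ?S\<^sup>2 = u * (t * u / ?S)"
      using S by (simp add: power2_eq_square)
    finally have 2: "?z \<in> horodisk (Some b) u"
      unfolding mem_horodisk_Some[OF assms(2)] complex.sel eq using assms S by simp
    show False using 1 2 disj by blast
  qed
next
  assume le: "t * u \<le> (b - a)\<^sup>2"
  have False if "z \<in> horodisk (Some a) t" "z \<in> horodisk (Some b) u" for z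
  proof -
    let ?c = "Complex a (t / 2)" and ?c' = "Complex b (u / 2)"
    have "cmod (z - ?c) < t / 2" "cmod (z - ?c') < u / 2" using that by auto
    then have "cmod (?c' - ?c) < t / 2 + u / 2"
      using norm_triangle_ineq4[of "z - ?c" "z - ?c'"] by (simp add: algebra_simps)
    then have "(cmod (?c' - ?c))\<^sup>2 < (t / 2 + u / 2)\<^sup>2" by (intro power_strict_mono) auto
    then have "(b - a)\<^sup>2 < t * u" unfolding cmod_power2 by (simp add: field_simps power2_eq_square)
    then show False using le by simp
  qed
  then show "horodisk (Some a) t \<inter> horodisk (Some b) u = {}" by blast
qed

text \<open>With \<open>L = b - a\<close> and \<open>r = L\<^sup>2 / (t * u)\<close>, the explicit intersection points give
  \<open>(r + 1 / r) / 2\<close> for the hyperbolic cosine of their distance; the computation rests on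
  \<open>(L\<^sup>2 + t * u)\<^sup>2 + L\<^sup>2 * (t - u)\<^sup>2 = (t\<^sup>2 + L\<^sup>2) * (u\<^sup>2 + L\<^sup>2)\<close>.\<close>

lemma lambda_length_squared_finite:
  assumes "0 < d (Some a)" "0 < d (Some b)" "a \<noteq> b"
  shows "(lambda_length d (Some a) (Some b))\<^sup>2 = (b - a)\<^sup>2 / (d (Some a) * d (Some b))"
proof (rule lambda_length_squared_eqI)
  define t u L where "t = d (Some a)" and "u = d (Some b)" and "L = b - a"
  have t: "0 < t" and u: "0 < u" and L: "L \<noteq> 0" using assms by (auto simp: t_def u_def L_def)
  define T U where "T = t\<^sup>2 + L\<^sup>2" and "U = u\<^sup>2 + L\<^sup>2"
  have T: "0 < T" and U: "0 < U" using t u by (auto simp: T_def U_def sum_power2_gt_zero_iff)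
  define r where "r = L\<^sup>2 / (t * u)"
  have r: "0 < r" using t u L by (simp add: r_def)
  show "0 < (b - a)\<^sup>2 / (d (Some a) * d (Some b))" using assms by simp
  let ?x = "Complex (a + t\<^sup>2 * L / T) (t * L\<^sup>2 / T)" and ?y = "Complex (b - u\<^sup>2 * L / U) (u * L\<^sup>2 / U)"
  have x: "(THE z. z \<in> geodesic (Some a) (Some b) \<inter> horocycle (Some a) t) = ?x"
    using geodesic_inter_horocycle[OF t assms(3)] by (simp add: T_def L_def)
  have y: "(THE z. z \<in> geodesic (Some a) (Some b) \<inter> horocycle (Some b) u) = ?y"
    using geodesic_inter_horocycle[OF u assms(3)[symmetric]]
    unfolding geodesic_commute[of "Some b"]
    by (simp add: U_def L_def power2_commute[of a b] minus_divide_left[symmetric])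
       (simp add: algebra_simps minus_divide_left diff_divide_distrib)
  have re: "Re (?x - ?y) = - (L * (L\<^sup>2 - t * u) * (L\<^sup>2 + t * u) / (T * U))"
  proof -
    have "Re (?x - ?y) = - (L - t\<^sup>2 * L / T - u\<^sup>2 * L / U)" by (simp add: L_def)
    also have "L - t\<^sup>2 * L / T - u\<^sup>2 * L / U = L * (T * U - t\<^sup>2 * U - u\<^sup>2 * T) / (T * U)"
      using T U by (simp add: field_simps)
    also have "T * U - t\<^sup>2 * U - u\<^sup>2 * T = (L\<^sup>2 - t * u) * (L\<^sup>2 + t * u)"
      by (simp add: T_def U_def power2_eq_square algebra_simps)
    finally show ?thesis by (simp add: mult.assoc)
  qed
  have im: "Im (?x - ?y) = L\<^sup>2 * (t - u) * (L\<^sup>2 - t * u) / (T * U)"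
  proof -
    have "Im (?x - ?y) = L\<^sup>2 * (t * U - u * T) / (T * U)" using T U by (simp add: field_simps)
    also have "t * U - u * T = (t - u) * (L\<^sup>2 - t * u)"
      by (simp add: T_def U_def power2_eq_square algebra_simps)
    finally show ?thesis by (simp add: mult.assoc)
  qed
  have factor: "(L * P * Q)\<^sup>2 + (L\<^sup>2 * R * P)\<^sup>2 = L\<^sup>2 * P\<^sup>2 * (Q\<^sup>2 + L\<^sup>2 * R\<^sup>2)" for P Q R
    by (simp add: power2_eq_square algebra_simps)
  have "(cmod (?x - ?y))\<^sup>2 =
      (L\<^sup>2 * (L\<^sup>2 - t * u)\<^sup>2 * ((L\<^sup>2 + t * u)\<^sup>2 + L\<^sup>2 * (t - u)\<^sup>2)) / (T * U)\<^sup>2"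
    unfolding cmod_power2 re im power2_minus power_divide add_divide_distrib[symmetric]
      factor ..
  also have "(L\<^sup>2 + t * u)\<^sup>2 + L\<^sup>2 * (t - u)\<^sup>2 = T * U"
    by (simp add: T_def U_def power2_eq_square algebra_simps)
  finally have "(cmod (?x - ?y))\<^sup>2 = L\<^sup>2 * (L\<^sup>2 - t * u)\<^sup>2 / (T * U)"
    using T U by (simp add: power2_eq_square)
  then have "1 + (cmod (?x - ?y))\<^sup>2 / (2 * Im ?x * Im ?y) =
      1 + (L\<^sup>2 * (L\<^sup>2 - t * u)\<^sup>2 / (T * U)) / (2 * (t * L\<^sup>2 / T) * (u * L\<^sup>2 / U))" by simp
  also have "\<dots> = 1 + (L\<^sup>2 - t * u)\<^sup>2 / (2 * t * u * L\<^sup>2)"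
    using T U t u L by (simp add: power2_eq_square)
  also have "\<dots> = (r + 1 / r) / 2"
    using t u L by (simp add: r_def field_simps power2_eq_square)
  finally have "hdist ?x ?y = \<bar>ln r\<bar>" unfolding hdist_def using arcosh_eq_abs_ln[OF r] by (rule ssubst)
  moreover have "t * u \<le> (b - a)\<^sup>2 \<longleftrightarrow> 1 \<le> r" using t u by (simp add: r_def L_def field_simps)
  ultimately have "horocycle_dist d (Some a) (Some b) = (if 1 \<le> r then \<bar>ln r\<bar> else - \<bar>ln r\<bar>)"
    unfolding horocycle_dist_def Let_def t_def[symmetric] u_def[symmetric] x y
      horodisks_disjoint_iff[OF t u] by simp
  then show "horocycle_dist d (Some a) (Some b) =
      (if 1 \<le> (b - a)\<^sup>2 / (d (Some a) * d (Some b))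
       then \<bar>ln ((b - a)\<^sup>2 / (d (Some a) * d (Some b)))\<bar>
       else - \<bar>ln ((b - a)\<^sup>2 / (d (Some a) * d (Some b)))\<bar>)"
    by (simp add: r_def t_def u_def L_def)
qed

section \<open>The Farey triangles with a vertex at infinity\<close>

lemma farey_triangles_reflect:
  assumes "T \<in> farey_triangles"
  shows "reflection (Some 0) None ` T \<in> farey_triangles"
    and "reflection (Some 1) None ` T \<in> farey_triangles"
proof -
  obtain g where g: "g \<in> farey_group" "T = g ` {Some 0, Some 1, None}"
    using assms unfolding farey_triangles_def by blast
  show "reflection (Some 0) None ` T \<in> farey_triangles"
    unfolding farey_triangles_def g(2) image_comp using farey_group.refl_0_inf[OF g(1)] by blast
  show "reflection (Some 1) None ` T \<in> farey_triangles"
    unfolding farey_triangles_def g(2) image_comp using farey_group.refl_1_inf[OF g(1)] by blast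
qed

lemma farey_triangle_0: "{Some 0, Some 1, None} \<in> farey_triangles"
  using farey_group.id unfolding farey_triangles_def by (intro CollectI exI[of _ id]) simp

lemma farey_triangle_m1: "{Some (- 1), Some 0, None} \<in> farey_triangles"
  using farey_triangles_reflect(1)[OF farey_triangle_0] by (simp add: insert_commute)

text \<open>Reflecting in the line above \<open>0\<close> and then in the line above \<open>1\<close> is the translation by \<open>2\<close>,
  which explains the induction in steps of two.\<close>

lemma farey_triangle_nat: "{Some (real n), Some (real n + 1), None} \<in> farey_triangles"
proof (induction n rule: induct_nat_012)
  case 0
  then show ?case using farey_triangle_0 by simp
next
  case 1
  then show ?case using farey_triangles_reflect(2)[OF farey_triangle_0] by (simp add: insert_commute)
next
  case (ge2 n)
  then show ?case
    using farey_triangles_reflect(2)[OF farey_triangles_reflect(1)[OF ge2(1)]]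
    by (simp add: insert_commute algebra_simps)
qed

lemma farey_edgeI: "{P, Q, A} \<in> farey_triangles \<Longrightarrow> P \<noteq> Q \<Longrightarrow> {P, Q} \<in> farey_edges"
  unfolding farey_edges_def by auto

text \<open>The images of positively oriented triangles are again positively oriented, so the sides of the
  edge need to be checked for the Farey triangles only.\<close>

lemma developing_map_shear:
  assumes "developing_map s h" "{P, Q, A} \<in> farey_triangles" "{P, Q, B} \<in> farey_triangles"
    and "cyc P Q A" "cyc Q P B" "P \<noteq> Q"
  shows "shear (h P) (h Q) (h A) (h B) = s {P, Q}"
proof -
  have "{P, Q} \<in> farey_edges" using assms farey_edgeI by blast
  moreover have "{h P, h Q, h A} \<in> (`) h ` farey_triangles" "{h P, h Q, h B} \<in> (`) h ` farey_triangles"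
    using imageI[OF assms(2), of "(`) h"] imageI[OF assms(3), of "(`) h"] by auto
  moreover have "cyc (h P) (h Q) (h A)" "cyc (h Q) (h P) (h B)"
    using assms unfolding developing_map_def orientation_preserving_def by blast+
  ultimately show ?thesis using assms(1) unfolding developing_map_def by auto
qed

section \<open>The developing map on the integers\<close>

text \<open>If \<open>h \<infinity> = y\<close> is finite, the triangles with third vertices \<open>-1\<close> and \<open>1\<close> have the same tangency
  point on the geodesic from \<open>0\<close> to \<open>y\<close>. Sending \<open>y\<close> to \<open>\<infinity>\<close> places it at the heights
  \<open>1 / \<bar>y * (1 + y)\<bar>\<close> and \<open>1 / \<bar>y * (1 - y)\<bar>\<close>, whose equality forces \<open>y = 0\<close>,
  although \<open>h\<close> separates \<open>0\<close> from \<open>\<infinity>\<close>.\<close>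

lemma developing_map_fixes_infinity:
  assumes dev: "developing_map s h" and s0: "s {Some 0, None} = 0"
    and fixed: "\<And>x. x \<in> {-1, 0, 1} \<Longrightarrow> h (Some x) = Some x"
  shows "h None = None"
proof (rule ccontr)
  assume "h None \<noteq> None"
  then obtain y where y: "h None = Some y" by blast
  have "cyc (h (Some 0)) (h None) (h (Some (-1)))" "cyc (h None) (h (Some 0)) (h (Some 1))"
    using dev unfolding developing_map_def orientation_preserving_def by auto
  then have ne: "y \<noteq> 0" "y \<noteq> 1" "y \<noteq> - 1" using y fixed by auto
  have "shear (h (Some 0)) (h None) (h (Some (-1))) (h (Some 1)) = s {Some 0, None}"
    using dev farey_triangle_0 farey_triangle_m1
    by (intro developing_map_shear) (simp_all add: insert_commute)
  then have "shear (Some 0) (Some y) (Some (-1)) (Some 1) = 0" using s0 y fixed by simp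
  then have "hdist (tangency_point (Some 0) (Some y) (Some (-1)))
      (tangency_point (Some 0) (Some y) (Some 1)) = 0"
    unfolding shear_def signed_dist_def by (auto split: if_splits)
  then have "tangency_point (Some 0) (Some y) (Some (-1)) = tangency_point (Some 0) (Some y) (Some 1)"
    using tangency_point_finite(1)[of 0 y] ne
    by (intro hdist_eq_0_imp_eq) (auto simp: upper_half_plane_def)
  then have "\<bar>1 / (-1 - y) - 1 / (0 - y)\<bar> = \<bar>1 / (1 - y) - 1 / (0 - y)\<bar>"
    using tangency_point_finite(2)[of 0 y "-1"] tangency_point_finite(2)[of 0 y 1] ne by simp
  moreover have "1 / (-1 - y) - 1 / (0 - y) = 1 / (y * (1 + y))"
    "1 / (1 - y) - 1 / (0 - y) = 1 / (y * (1 - y))"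
    using ne by (simp_all add: divide_simps)
  ultimately have "\<bar>1 + y\<bar> = \<bar>1 - y\<bar>" using ne by (simp add: abs_mult)
  then show False using ne by linarith
qed

theorem proposition2p6:
  fixes s :: "ideal_point set \<Rightarrow> real" and h :: "ideal_point \<Rightarrow> ideal_point"
  assumes "\<And>j::nat. s {Some (- (16 ^ j)), None} = ln 2"
    and "\<And>j::nat. s {Some (16 ^ j), None} = - ln 2"
    and "\<And>E. \<lbrakk>E \<in> farey_edges; \<And>j::nat. E \<noteq> {Some (- (16 ^ j)), None};
               \<And>j::nat. E \<noteq> {Some (16 ^ j), None}\<rbrakk> \<Longrightarrow> s E = 0"
    and "developing_map s h"
    and "\<And>x. x \<in> {-1..1} \<Longrightarrow> h (Some x) = Some x"
  shows "\<not> (\<exists>d. decoration (h ` farey_vertices) d \<and> pinched h d)"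
proof
  assume "\<exists>d. decoration (h ` farey_vertices) d \<and> pinched h d"
  then obtain d M where dec: "decoration (h ` farey_vertices) d" and M: "1 < M"
    and pinch: "\<And>p q. {p, q} \<in> farey_edges \<Longrightarrow>
      1 / M \<le> lambda_length d (h p) (h q) \<and> lambda_length d (h p) (h q) \<le> M"
    unfolding pinched_def by blast

  have edge_inf: "{Some (real n), None} \<in> farey_edges" for n
    using farey_triangle_nat[of n] by (intro farey_edgeI[where A = "Some (real n + 1)"])
      (simp_all add: insert_commute)
  have edge_nat: "{Some (real n), Some (real n + 1)} \<in> farey_edges" for n
    using farey_triangle_nat[of n] by (intro farey_edgeI[where A = None]) simp_all
  have s0: "s {Some (real n), None} = 0" if "\<And>j. n \<noteq> 16 ^ j" for n
  proof (rule assms(3)[OF edge_inf])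
    fix j :: nat
    show "{Some (real n), None} \<noteq> {Some (16 ^ j), None}"
      using that[of j] by (metis doubleton_eq_iff option.distinct(1) option.inject of_nat_eq_iff
          of_nat_power of_nat_numeral)
    have "real n \<noteq> - (16 ^ j)"
      by (smt (verit) of_nat_0_le_iff zero_less_power)
    then show "{Some (real n), None} \<noteq> {Some (- (16 ^ j)), None}"
      by (metis doubleton_eq_iff option.distinct(1) option.inject)
  qed
  have inf: "h None = None"
  proof (rule developing_map_fixes_infinity[OF assms(4)])
    show "s {Some 0, None} = 0" using s0[of 0] by simp
    show "h (Some x) = Some x" if "x \<in> {-1, 0, 1}" for x using that assms(5) by auto
  qed

  have cyc_h: "cyc (h a) (h b) (h c)" if "cyc a b c" for a b c
    using that assms(4) unfolding developing_map_def orientation_preserving_def by blast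
  define H where "H x = the (h (Some x))" for x
  have H: "h (Some x) = Some (H x)" for x
    using cyc_h[of None "Some x" "Some (x + 1)"] inf by (cases "h (Some x)") (auto simp: H_def)
  have H_less: "H x < H y" if "x < y" for x y
    using cyc_h[of None "Some x" "Some y"] that by (simp add: inf H)

  \<comment> \<open>The increments: each is obtained from its predecessor by the shear along the edge between them.\<close>
  define D where "D n = H (real n + 1) - H (real n)" for n
  have D_pos: "0 < D n" for n using H_less[of "real n" "real n + 1"] by (simp add: D_def)
  have D_step: "D (Suc n) = D n * exp (s {Some (real (Suc n)), None})" for n
  proof -
    let ?m = "real (Suc n)"
    have "{Some ?m, None, Some (real n)} \<in> farey_triangles"
      using farey_triangle_nat[of n] by (simp add: insert_commute add.commute)
    moreover have "{Some ?m, None, Some (?m + 1)} \<in> farey_triangles"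
      using farey_triangle_nat[of "Suc n"] by (simp add: insert_commute)
    ultimately have "shear (h (Some ?m)) (h None) (h (Some (real n))) (h (Some (?m + 1))) =
        s {Some ?m, None}"
      by (rule developing_map_shear[OF assms(4)]) auto
    then have "ln ((H (?m + 1) - H ?m) / (H ?m - H (real n))) = s {Some ?m, None}"
      unfolding inf H by (subst (asm) shear_at_infinity) (auto intro: H_less)
    then have "ln (D (Suc n) / D n) = s {Some ?m, None}" by (simp add: D_def add.commute)
    then have "D (Suc n) / D n = exp (s {Some ?m, None})"
      using D_pos by (metis divide_pos_pos exp_ln)
    then show ?thesis using D_pos[of n] by (simp add: field_simps)
  qed
  have D_half: "D (Suc n) = D n / 2" if "Suc n = 16 ^ j" for n j
  proof -
    have "real (Suc n) = 16 ^ j" using that by (metis of_nat_numeral of_nat_power)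
    then have "s {Some (real (Suc n)), None} = - ln 2" using assms(2)[of j] by simp
    then show ?thesis using D_step[of n] by (simp add: exp_minus)
  qed
  have "D (Suc n) \<le> D n" for n
  proof (cases "\<exists>j. Suc n = 16 ^ j")
    case True
    then obtain j where "Suc n = 16 ^ j" by blast
    then show ?thesis using D_half[of n j] D_pos[of n] by linarith
  next
    case False
    then show ?thesis using D_step[of n] s0[of "Suc n"] by simp
  qed
  then have D_antimono: "D n \<le> D m" if "m \<le> n" for m n
    using that by (rule lift_Suc_antimono_le)
  have D_bound: "D (16 ^ j) \<le> D 0 * (1 / 2) ^ j" for j
  proof (induction j)
    case 0
    then show ?case using D_antimono[of 0 1] by simp
  next
    case (Suc j)
    \<comment> \<open>the halving happens in the step from \<open>16 ^ Suc j - 1\<close>, which is still at least \<open>16 ^ j\<close>\<close>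
    obtain n where n: "Suc n = 16 ^ Suc j" by (metis not0_implies_Suc power_not_zero zero_neq_numeral)
    have "1 \<le> (16::nat) ^ j" by simp
    then have "16 ^ j \<le> n" using n by simp
    then have "D (16 ^ Suc j) \<le> D (16 ^ j) / 2" using D_half[OF n] D_antimono[of "16 ^ j" n] n by simp
    then show ?case using Suc by simp
  qed

  \<comment> \<open>The decoration bounds the increments from below.\<close>
  have d_inf: "0 < d None" and d_nat: "0 < d (Some (H (real n)))" for n
  proof -
    have v: "None \<in> farey_vertices" "Some (real n) \<in> farey_vertices" for n
      using farey_triangle_nat[of n] unfolding farey_vertices_def by blast+
    show "0 < d None" "0 < d (Some (H (real n)))" for n
      using dec v imageI[OF v(1), of h] imageI[OF v(2), of h n] unfolding decoration_def inf H by auto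
  qed
  have d_lower: "d None / M\<^sup>2 \<le> d (Some (H (real n)))" for n
  proof -
    have "0 \<le> lambda_length d (Some (H (real n))) None" by (simp add: lambda_length_def)
    then have "(lambda_length d (Some (H (real n))) None)\<^sup>2 \<le> M\<^sup>2"
      using pinch[OF edge_inf[of n]] by (intro power_mono) (auto simp: inf H)
    then have "d None / d (Some (H (real n))) \<le> M\<^sup>2"
      using lambda_length_squared_vertical[of d "H (real n)"] d_inf d_nat by simp
    then show ?thesis using d_nat[of n] M by (simp add: field_simps)
  qed
  define c where "c = d None / M\<^sup>2 / M"
  have c: "0 < c" using d_inf M by (simp add: c_def)
  have D_lower: "c \<le> D n" for n
  proof -
    let ?t = "d (Some (H (real n)))" and ?u = "d (Some (H (real n + 1)))"
    have tu: "0 < ?t" "0 < ?u" "d None / M\<^sup>2 \<le> ?t" "d None / M\<^sup>2 \<le> ?u"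
      using d_nat[of n] d_nat[of "Suc n"] d_lower[of n] d_lower[of "Suc n"]
      by (simp_all add: add.commute)
    have "c\<^sup>2 = (1 / M)\<^sup>2 * (d None / M\<^sup>2 * (d None / M\<^sup>2))"
      by (simp add: c_def power2_eq_square)
    also have "\<dots> \<le> (1 / M)\<^sup>2 * (?t * ?u)"
      using tu d_inf M by (intro mult_left_mono mult_mono) auto
    also have "\<dots> \<le> (lambda_length d (Some (H (real n))) (Some (H (real n + 1))))\<^sup>2 * (?t * ?u)"
      using pinch[OF edge_nat[of n]] tu M by (intro mult_right_mono power_mono) (auto simp: H)
    also have "\<dots> = (D n)\<^sup>2"
      using lambda_length_squared_finite[of d "H (real n)" "H (real n + 1)"] tu D_pos[of n]
      by (auto simp: D_def)
    finally show ?thesis using c D_pos[of n] by (simp add: power_mono_iff)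
  qed
  obtain j where "(1 / 2) ^ j < c / D 0"
    using real_arch_pow_inv[of "c / D 0" "1 / 2"] c D_pos[of 0] by auto
  then have "D 0 * (1 / 2) ^ j < c" using D_pos[of 0] by (simp add: field_simps)
  then show False using D_bound[of j] D_lower[of "16 ^ j"] by linarith
qed

end
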